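(* Let $q:\mathbb{R}\to(0,\infty)$ be a fixed positive polynomial of degree $2m$, $m\in\mathbb{N}$, with associated weights $\rho_\kappa=q^{-\kappa/(2m)}$, $\kappa\in\mathbb{R}$. Let $1<p<\infty$, $\upsilon\in\mathbb{R}$, $\alpha\in\mathbb{N}$ and $\beta\in\mathbb{R}$. There is a constant $c>0$, independent of $n$ and of the quadrature rule, such that for every $n\in\mathbb{N}$ and every linear $n$-point quadrature rule $A_{\rho_\upsilon,n}(f)=\sum_{j=1}^n w_jf(x_j)$ with weights $w_1,\dots,w_n\in\mathbb{R}$ and nodes $x_1,\dots,x_n\in\mathbb{R}$, $$\sup_{0\ne f\in\widetilde W^{\alpha,p}_{\rho_\beta}(\mathbb{R})}\frac{|I_{\rho_\upsilon}(f)-A_{\rho_\upsilon,n}(f)|}{\|f\|_{\widetilde W^{\alpha,p}_{\rho_\beta}(\mathbb{R})}}\ \ge\ c\,n^{-\alpha}.$$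
   Context: $\mathbb{N}=\{1,2,\dots\}$. Functions are complex-valued; polynomials have real coefficients. Weights: for the fixed strictly positive polynomial $q$ of degree $2m$ on $\mathbb{R}$, $\rho_\kappa(x)=(q(x))^{-\kappa/(2m)}$ for $x\in\mathbb{R}$ and $\kappa\in\mathbb{R}$. $L^p_{\rho_\kappa}(\mathbb{R})$ is the space of Lebesgue measurable functions with finite norm $\|f\|_{L^p_{\rho_\kappa}(\mathbb{R})}=\big(\int_{\mathbb{R}}|f(x)|^p\rho_\kappa(x)\,dx\big)^{1/p}$. Variable-weight Sobolev space: $\widetilde W^{\alpha,p}_{\rho_\kappa}(\mathbb{R})$ is the set of $f\in L^p_{\rho_{\kappa+\alpha p}}(\mathbb{R})$ with weak derivatives $f^{(\tau)}$ up to order $\alpha$ such that $$\|f\|_{\widetilde W^{\alpha,p}_{\rho_\kappa}(\mathbb{R})}=\Big(\sum_{\tau=0}^{\alpha}\int_{\mathbb{R}}|f^{(\tau)}(x)|^p\,\rho_{\kappa+p(\alpha-\tau)}(x)\,dx\Big)^{1/p}<\infty.$$ Since $\alpha\ge1$ such $f$ have continuous representatives, which are used for point evaluations. Integral: $I_{\rho_\upsilon}(f)=\int_{\mathbb{R}}f(x)\rho_\upsilon(x)\,dx$. The supremum is taken over those nonzero $f$ for which this integral converges absolutely, and it may be $+\infty$. *)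

theory Defs
  imports "HOL-Analysis.Analysis" "HOL-Computational_Algebra.Polynomial"
begin

definition rho :: "real poly \<Rightarrow> nat \<Rightarrow> real \<Rightarrow> real \<Rightarrow> real" where
  "rho q m \<kappa> x = poly q x powr (- \<kappa> / (2 * real m))"

definition weighted_Lp :: "real \<Rightarrow> (real \<Rightarrow> real) \<Rightarrow> (real \<Rightarrow> complex) set" where
  "weighted_Lp p \<rho> =
     {f \<in> borel_measurable lebesgue.
        (\<integral>\<^sup>+ x. ennreal (cmod (f x) powr p * \<rho> x) \<partial>lebesgue) < \<infinity>}"

definition locally_integrable :: "(real \<Rightarrow> complex) \<Rightarrow> bool" where
  "locally_integrable f \<longleftrightarrow> (\<forall>K. compact K \<longrightarrow> set_integrable lebesgue K f)"

definition iter_deriv :: "nat \<Rightarrow> (real \<Rightarrow> complex) \<Rightarrow> real \<Rightarrow> complex" where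
  "iter_deriv k = (\<lambda>g x. vector_derivative g (at x)) ^^ k"

definition test_functions :: "(real \<Rightarrow> complex) set" where
  "test_functions =
     {\<phi>. (\<forall>k x. iter_deriv k \<phi> differentiable (at x)) \<and>
          compact (closure {x. \<phi> x \<noteq> 0})}"

definition has_weak_deriv :: "nat \<Rightarrow> (real \<Rightarrow> complex) \<Rightarrow> (real \<Rightarrow> complex) \<Rightarrow> bool" where
  "has_weak_deriv \<tau> f g \<longleftrightarrow>
     locally_integrable f \<and> locally_integrable g \<and>
     (\<forall>\<phi>\<in>test_functions.
        (LINT x|lebesgue. f x * iter_deriv \<tau> \<phi> x) =
        (-1) ^ \<tau> * (LINT x|lebesgue. g x * \<phi> x))"

(* Weak derivatives are unique only up to null sets; the choice is irrelevant under
   the integrals below. *)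
definition weak_deriv :: "nat \<Rightarrow> (real \<Rightarrow> complex) \<Rightarrow> real \<Rightarrow> complex" where
  "weak_deriv \<tau> f = (SOME g. has_weak_deriv \<tau> f g)"

(* The p-th power of the Sobolev norm; it may be infinite. *)
definition sobolev_energy ::
  "real poly \<Rightarrow> nat \<Rightarrow> nat \<Rightarrow> real \<Rightarrow> real \<Rightarrow> (real \<Rightarrow> complex) \<Rightarrow> ennreal" where
  "sobolev_energy q m \<alpha> p \<kappa> f =
     (\<Sum>\<tau>=0..\<alpha>. \<integral>\<^sup>+ x. ennreal (cmod (weak_deriv \<tau> f x) powr p
                        * rho q m (\<kappa> + p * (real \<alpha> - real \<tau>)) x) \<partial>lebesgue)"

definition sobolev_norm ::
  "real poly \<Rightarrow> nat \<Rightarrow> nat \<Rightarrow> real \<Rightarrow> real \<Rightarrow> (real \<Rightarrow> complex) \<Rightarrow> real" where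
  "sobolev_norm q m \<alpha> p \<kappa> f = enn2real (sobolev_energy q m \<alpha> p \<kappa> f) powr (1 / p)"

(* Elements are functions, not equivalence classes modulo null sets. *)
definition sobolev_space ::
  "real poly \<Rightarrow> nat \<Rightarrow> nat \<Rightarrow> real \<Rightarrow> real \<Rightarrow> (real \<Rightarrow> complex) set" where
  "sobolev_space q m \<alpha> p \<kappa> =
     {f \<in> weighted_Lp p (rho q m (\<kappa> + real \<alpha> * p)).
        (\<forall>\<tau>\<le>\<alpha>. \<exists>g. has_weak_deriv \<tau> f g) \<and> sobolev_energy q m \<alpha> p \<kappa> f < \<infinity>}"

(* The continuous function equal to f almost everywhere, unique when it exists. *)
definition cont_rep :: "(real \<Rightarrow> complex) \<Rightarrow> real \<Rightarrow> complex" where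
  "cont_rep f = (SOME g. continuous_on UNIV g \<and> (AE x in lebesgue. f x = g x))"

definition weighted_integral :: "(real \<Rightarrow> real) \<Rightarrow> (real \<Rightarrow> complex) \<Rightarrow> complex" where
  "weighted_integral \<rho> f = (LINT x|lebesgue. f x * complex_of_real (\<rho> x))"

definition quadrature ::
  "nat \<Rightarrow> (nat \<Rightarrow> real) \<Rightarrow> (nat \<Rightarrow> real) \<Rightarrow> (real \<Rightarrow> complex) \<Rightarrow> complex" where
  "quadrature n w x f = (\<Sum>j=1..n. complex_of_real (w j) * cont_rep f (x j))"

(* f ranges over representatives, so "nonzero" means not almost everywhere zero. *)
definition admissible ::
  "real poly \<Rightarrow> nat \<Rightarrow> nat \<Rightarrow> real \<Rightarrow> real \<Rightarrow> real \<Rightarrow> (real \<Rightarrow> complex) set" where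
  "admissible q m \<alpha> p \<beta> \<upsilon> =
     {f \<in> sobolev_space q m \<alpha> p \<beta>. \<not> (AE x in lebesgue. f x = 0) \<and>
        integrable lebesgue (\<lambda>x. f x * complex_of_real (rho q m \<upsilon> x))}"

end

theory Submission
  imports Defs
begin

text \<open>
  Cut \<open>[0, 1]\<close> into \<open>2 * n\<close> cells. At least \<open>n\<close> of them contain no node in their interior, and the sum
  \<open>f\<close> of the bumps rescaled to these cells vanishes at all nodes, so the quadrature error is the
  integral of \<open>f\<close>, which is bounded below since the weight is bounded below on \<open>[0, 1]\<close>. The bumps have
  disjoint supports, so the derivative of order \<open>\<tau>\<close> is of size at most \<open>(2 * n) ^ \<tau>\<close> up to a constant
  and the norm of \<open>f\<close> is of order at most \<open>n powr \<alpha>\<close>.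

  The norm is computed from arbitrarily chosen weak derivatives and junk division by a zero norm would
  make the quotient 0. Both are handled by the uniqueness of weak derivatives.
\<close>

subsection \<open>Smooth functions\<close>

text \<open>The differentiability clause of \<open>test_functions\<close> taken alone, so that
  smoothness can be treated apart from the support.\<close>

definition smooth_fun :: "(real \<Rightarrow> complex) \<Rightarrow> bool" where
  "smooth_fun f \<longleftrightarrow> (\<forall>k x. iter_deriv k f differentiable (at x))"

lemma iter_deriv_0 [simp]: "iter_deriv 0 f = f"
  by (simp add: iter_deriv_def)

lemma iter_deriv_Suc: "iter_deriv (Suc k) f = (\<lambda>x. vector_derivative (iter_deriv k f) (at x))"
  by (simp add: iter_deriv_def)

lemma iter_deriv_add: "iter_deriv (j + k) f = iter_deriv j (iter_deriv k f)"
  by (simp add: iter_deriv_def funpow_add)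

lemma smooth_has_deriv:
  "smooth_fun f \<Longrightarrow> (iter_deriv k f has_vector_derivative iter_deriv (Suc k) f x) (at x)"
  unfolding smooth_fun_def iter_deriv_Suc by (metis vector_derivative_works)

lemma smooth_iter_deriv: "smooth_fun f \<Longrightarrow> smooth_fun (iter_deriv k f)"
  by (simp add: smooth_fun_def flip: iter_deriv_add)

lemma smooth_continuous_on: "smooth_fun f \<Longrightarrow> continuous_on A (iter_deriv k f)"
  by (meson continuous_at_imp_continuous_on has_vector_derivative_continuous smooth_has_deriv)

text \<open>By induction all iterated derivatives remain in \<open>S\<close>. This gives smoothness
  without a formula for the derivative of order \<open>k\<close>.\<close>

lemma smooth_invariant:
  assumes "f \<in> S"
    and S: "\<And>f. f \<in> S \<Longrightarrow> \<exists>g\<in>S. \<forall>x. (f has_vector_derivative g x) (at x)"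
  shows "smooth_fun f"
proof -
  have "iter_deriv k f \<in> S" for k
  proof (induction k)
    case (Suc k)
    then obtain g where g: "g \<in> S" "\<And>x. (iter_deriv k f has_vector_derivative g x) (at x)"
      using S by blast
    then have "iter_deriv (Suc k) f = g"
      by (auto simp: iter_deriv_Suc vector_derivative_at)
    with g show ?case by simp
  qed (simp add: assms)
  then show ?thesis
    using S unfolding smooth_fun_def by (meson differentiableI_vector)
qed

text \<open>Serves where the derivatives of all orders can be guessed: uniqueness of derivatives
  identifies them with the sequence \<open>D\<close>.\<close>

lemma iter_deriv_eqI:
  assumes "D 0 = f" and D: "\<And>k x. (D k has_vector_derivative D (Suc k) x) (at x)"
  shows "iter_deriv k f = D k"
  by (induction k) (use D in \<open>auto simp: iter_deriv_Suc assms(1) vector_derivative_at\<close>)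

lemma smooth_funI:
  assumes "D 0 = f" and D: "\<And>k x. (D k has_vector_derivative D (Suc k) x) (at x)"
  shows "smooth_fun f"
  unfolding smooth_fun_def iter_deriv_eqI[of D, OF assms]
  using D by (meson differentiableI_vector)

lemma
  assumes "\<And>i. i \<in> S \<Longrightarrow> smooth_fun (f i)"
  shows smooth_sum: "smooth_fun (\<lambda>x. \<Sum>i\<in>S. f i x)"
    and iter_deriv_sum: "iter_deriv k (\<lambda>x. \<Sum>i\<in>S. f i x) = (\<lambda>x. \<Sum>i\<in>S. iter_deriv k (f i) x)"
proof -
  let ?D = "\<lambda>k x. \<Sum>i\<in>S. iter_deriv k (f i) x"
  have D: "(?D k has_vector_derivative ?D (Suc k) x) (at x)" for k x
    by (intro has_vector_derivative_sum smooth_has_deriv assms)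
  have D0: "?D 0 = (\<lambda>x. \<Sum>i\<in>S. f i x)" by simp
  show "smooth_fun (\<lambda>x. \<Sum>i\<in>S. f i x)" by (rule smooth_funI[of ?D, OF D0 D])
  show "iter_deriv k (\<lambda>x. \<Sum>i\<in>S. f i x) = ?D k" by (rule iter_deriv_eqI[of ?D, OF D0 D])
qed

lemma
  assumes "smooth_fun f"
  shows smooth_affine: "smooth_fun (\<lambda>x. f (a * x + b))"
    and iter_deriv_affine:
      "iter_deriv k (\<lambda>x. f (a * x + b)) = (\<lambda>x. of_real (a ^ k) * iter_deriv k f (a * x + b))"
proof -
  let ?D = "\<lambda>k x. of_real (a ^ k) * iter_deriv k f (a * x + b)"
  have D: "(?D k has_vector_derivative ?D (Suc k) x) (at x)" for k x
  proof -
    have "((\<lambda>x. a * x + b) has_vector_derivative a) (at x)"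
      by (auto intro!: derivative_eq_intros)
    from vector_diff_chain_at[OF this smooth_has_deriv[OF assms]]
    have "((\<lambda>x. iter_deriv k f (a * x + b)) has_vector_derivative
        a *\<^sub>R iter_deriv (Suc k) f (a * x + b)) (at x)"
      by (simp add: o_def)
    from has_vector_derivative_mult_right[OF this, of "of_real (a ^ k)"]
    show ?thesis
      by (simp add: scaleR_conv_of_real mult_ac)
  qed
  have D0: "?D 0 = (\<lambda>x. f (a * x + b))" by simp
  show "smooth_fun (\<lambda>x. f (a * x + b))" by (rule smooth_funI[of ?D, OF D0 D])
  show "iter_deriv k (\<lambda>x. f (a * x + b)) = ?D k" by (rule iter_deriv_eqI[of ?D, OF D0 D])
qed

text \<open>The sums of products of smooth functions are closed under differentiation, so
  \<open>smooth_invariant\<close> applies and no Leibniz formula for iterated derivatives is needed.\<close>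

inductive_set smooth_products :: "(real \<Rightarrow> complex) set" where
  mult: "smooth_fun f \<Longrightarrow> smooth_fun g \<Longrightarrow> (\<lambda>x. f x * g x) \<in> smooth_products"
| add: "a \<in> smooth_products \<Longrightarrow> b \<in> smooth_products \<Longrightarrow> (\<lambda>x. a x + b x) \<in> smooth_products"

lemma smooth_mult:
  assumes "smooth_fun f" "smooth_fun g"
  shows "smooth_fun (\<lambda>x. f x * g x)"
proof (rule smooth_invariant)
  show "(\<lambda>x. f x * g x) \<in> smooth_products"
    using assms by (rule smooth_products.mult)
  fix h assume "h \<in> smooth_products"
  then show "\<exists>g\<in>smooth_products. \<forall>x. (h has_vector_derivative g x) (at x)"
  proof induction
    case (mult f g)
    let ?d = "iter_deriv 1"
    have "((\<lambda>x. f x * g x) has_vector_derivative f x * ?d g x + ?d f x * g x) (at x)" for x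
      using has_vector_derivative_mult[OF smooth_has_deriv[OF mult(1), of 0]
          smooth_has_deriv[OF mult(2), of 0]] by simp
    moreover have "(\<lambda>x. f x * ?d g x + ?d f x * g x) \<in> smooth_products"
      by (intro smooth_products.intros smooth_iter_deriv mult)
    ultimately show ?case by (intro bexI[of _ "\<lambda>x. f x * ?d g x + ?d f x * g x"] allI)
  next
    case (add a b)
    then obtain a' b' where "a' \<in> smooth_products" "b' \<in> smooth_products"
      "\<And>x. (a has_vector_derivative a' x) (at x)" "\<And>x. (b has_vector_derivative b' x) (at x)"
      by blast
    then show ?case
      by (intro bexI[of _ "\<lambda>x. a' x + b' x"] allI has_vector_derivative_add smooth_products.add)
  qed
qed

section \<open>Compact support and test functions\<close>

text \<open>The complement of a closed interval is open, so the function vanishes near each of its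
  points and each derivative does too.\<close>

lemma iter_deriv_zero_outside:
  assumes "smooth_fun f" "\<And>x. x \<notin> {a..b} \<Longrightarrow> f x = 0" "x \<notin> {a..b}"
  shows "iter_deriv k f x = 0"
  using assms(3)
proof (induction k arbitrary: x)
  case (Suc k)
  have "((\<lambda>x. 0) has_vector_derivative iter_deriv (Suc k) f x) (at x)"
    by (rule has_vector_derivative_transform_within_open[OF smooth_has_deriv[OF assms(1)],
          of "- {a..b}"]) (use Suc in auto)
  then show ?case
    using has_vector_derivative_const vector_derivative_unique_at by blast
qed (use assms(2) in auto)

lemma test_functionsI:
  assumes "smooth_fun \<phi>" "\<And>x. x \<notin> {a..b} \<Longrightarrow> \<phi> x = 0"
  shows "\<phi> \<in> test_functions"
proof -
  have "{x. \<phi> x \<noteq> 0} \<subseteq> {a..b}" using assms(2) by blast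
  then have "bounded {x. \<phi> x \<noteq> 0}" using bounded_closed_interval bounded_subset by blast
  then show ?thesis
    using assms(1) by (simp add: test_functions_def smooth_fun_def)
qed

lemma test_functionsE:
  assumes "\<phi> \<in> test_functions"
  obtains a b where "smooth_fun \<phi>" "a \<le> b" "\<And>x. x \<notin> {a..b} \<Longrightarrow> \<phi> x = 0"
proof -
  have "bounded {x. \<phi> x \<noteq> 0}"
    using assms bounded_subset[OF compact_imp_bounded closure_subset] by (simp add: test_functions_def)
  then obtain r where r: "\<And>x. \<phi> x \<noteq> 0 \<Longrightarrow> \<bar>x\<bar> \<le> r"
    unfolding bounded_iff by auto
  show ?thesis
  \<comment> \<open>If \<open>\<phi>\<close> vanishes everywhere, \<open>r\<close> may be negative;
    the absolute value keeps the interval nonempty.\<close>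
  proof (rule that[of "-\<bar>r\<bar>" "\<bar>r\<bar>"])
    show "smooth_fun \<phi>" using assms by (simp add: test_functions_def smooth_fun_def)
    show "\<phi> x = 0" if "x \<notin> {- \<bar>r\<bar>..\<bar>r\<bar>}" for x
      using r[of x] that by fastforce
  qed simp
qed

subsection \<open>Bump functions\<close>

text \<open>For \<open>P = 1\<close> this is the classical smooth function that is flat at 0. The
  polynomial parameter makes the family closed under differentiation, as
  \<open>smooth_invariant\<close> requires.\<close>

definition flat :: "real poly \<Rightarrow> real \<Rightarrow> real" where
  "flat P x = (if x > 0 then poly P (1 / x) * exp (- 1 / x) else 0)"

lemma tendsto_poly_times_exp_minus:
  "((\<lambda>y::real. poly P y * exp (- y)) \<longlongrightarrow> 0) at_top"
proof -
  have "((\<lambda>y. \<Sum>i\<le>degree P. coeff P i * (y ^ i / exp y)) \<longlongrightarrow> (\<Sum>i\<le>degree P. coeff P i * 0)) at_top"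
    by (intro tendsto_intros tendsto_power_div_exp_0)
  then show ?thesis
    by (simp add: poly_altdef sum_distrib_right exp_minus divide_inverse mult.assoc)
qed

text \<open>From the right, \<open>y = 1 / x\<close> reduces the claim to the decay of a polynomial
  times \<open>exp (- y)\<close>; on the left the function is 0.\<close>

lemma tendsto_flat_0: "(flat P \<longlongrightarrow> 0) (at 0)"
proof -
  have "filterlim (\<lambda>x::real. 1 / x) at_top (at_right 0)"
    using filterlim_inverse_at_top_right by (simp add: inverse_eq_divide)
  from filterlim_compose[OF tendsto_poly_times_exp_minus this]
  have "((\<lambda>x. poly P (1 / x) * exp (- (1 / x))) \<longlongrightarrow> 0) (at_right 0)" .
  then have "(flat P \<longlongrightarrow> 0) (at_right 0)"
    by (rule Lim_transform_eventually)
      (auto simp: flat_def eventually_at_right_less intro: eventually_mono[OF eventually_at_right_less])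
  moreover have "(flat P \<longlongrightarrow> 0) (at_left 0)"
    by (rule tendsto_eventually)
      (auto simp: flat_def eventually_at_filter)
  ultimately show ?thesis by (simp add: filterlim_split_at)
qed

text \<open>With \<open>y = 1 / x\<close> the chain rule contributes \<open>- y^2\<close>, so
  \<open>P\<close> turns into \<open>y^2 * (P - P')\<close>, and \<open>[:0, 0, 1:]\<close> is the
  polynomial \<open>y^2\<close>.\<close>

lemma flat_has_derivative:
  "(flat P has_real_derivative flat ([:0, 0, 1:] * (P - pderiv P)) x) (at x)"
proof (cases x "0::real" rule: linorder_cases)
  case less
  have "((\<lambda>x. 0) has_real_derivative 0) (at x)" by simp
  then have "(flat P has_real_derivative 0) (at x)"
    by (rule has_field_derivative_transform_within_open[of _ _ _ "{..<0}"]) (use less in \<open>auto simp: flat_def\<close>)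
  then show ?thesis using less by (simp add: flat_def)
next
  case equal
  \<comment> \<open>Dividing by \<open>h\<close> multiplies the polynomial in \<open>1 / h\<close>
    by its variable, so the difference quotient at 0 is again a member of the family.\<close>
  have "((\<lambda>h. flat ([:0, 1:] * P) h) \<longlongrightarrow> 0) (at 0)" by (rule tendsto_flat_0)
  then have "((\<lambda>h. (flat P (0 + h) - flat P 0) / h) \<longlongrightarrow> 0) (at 0)"
    by (rule Lim_transform_eventually)
      (auto simp: flat_def eventually_at_filter intro!: always_eventually)
  then show ?thesis using equal by (simp add: DERIV_def flat_def)
next
  case greater
  have "((\<lambda>x. poly P (1 / x) * exp (- 1 / x)) has_real_derivative
      flat ([:0, 0, 1:] * (P - pderiv P)) x) (at x)"
  proof -
    have "((\<lambda>x. 1 / x) has_real_derivative - 1 / x\<^sup>2) (at x)"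
      using greater by (auto intro!: derivative_eq_intros simp: field_simps power2_eq_square)
    from DERIV_chain2[OF poly_DERIV[of P] this]
    have "((\<lambda>x. poly P (1 / x)) has_real_derivative poly (pderiv P) (1 / x) * (- 1 / x\<^sup>2)) (at x)" .
    moreover have "((\<lambda>x. exp (- 1 / x)) has_real_derivative exp (- 1 / x) * (1 / x\<^sup>2)) (at x)"
      using greater by (auto intro!: derivative_eq_intros simp: field_simps power2_eq_square)
    ultimately have "((\<lambda>x. poly P (1 / x) * exp (- 1 / x)) has_real_derivative
        poly P (1 / x) * (exp (- 1 / x) * (1 / x\<^sup>2)) +
        poly (pderiv P) (1 / x) * (- 1 / x\<^sup>2) * exp (- 1 / x)) (at x)"
      by (rule DERIV_mult')
    then show ?thesis
      using greater by (simp add: flat_def algebra_simps power2_eq_square)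
  qed
  then show ?thesis
    by (rule has_field_derivative_transform_within_open[of _ _ _ "{0<..}"]) (use greater in \<open>auto simp: flat_def\<close>)
qed

lemma smooth_flat: "smooth_fun (\<lambda>x. of_real (flat P x))"
proof (rule smooth_invariant[of _ "range (\<lambda>P x. of_real (flat P x))"])
  fix f :: "real \<Rightarrow> complex" assume "f \<in> range (\<lambda>P x. of_real (flat P x))"
  then obtain P where f: "f = (\<lambda>x. of_real (flat P x))" by blast
  have "(f has_vector_derivative of_real (flat ([:0, 0, 1:] * (P - pderiv P)) x)) (at x)" for x
    unfolding f by (intro has_vector_derivative_of_real flat_has_derivative)
  then show "\<exists>g\<in>range (\<lambda>P x. of_real (flat P x)). \<forall>x. (f has_vector_derivative g x) (at x)"
    by (intro bexI[of _ "\<lambda>x. of_real (flat ([:0, 0, 1:] * (P - pderiv P)) x)"]) auto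
qed auto

definition bump :: "real \<Rightarrow> real" where
  "bump x = flat 1 x * flat 1 (1 - x)"

lemma flat_1: "flat 1 x = (if x > 0 then exp (- 1 / x) else 0)"
  by (simp add: flat_def)

lemma flat_1_bounds: "0 \<le> flat 1 x" "flat 1 x \<le> 1"
  by (auto simp: flat_1)

lemma smooth_bump: "smooth_fun (\<lambda>x. of_real (bump x))"
  using smooth_mult[OF smooth_flat[of 1] smooth_affine[OF smooth_flat[of 1], of "-1" 1]]
  by (simp add: bump_def)

lemma bump_nonneg: "0 \<le> bump x"
  by (simp add: bump_def flat_1_bounds)

lemma bump_eq_0: "x \<notin> {0<..<1} \<Longrightarrow> bump x = 0"
  by (auto simp: bump_def flat_1)

text \<open>On the middle half of the unit interval both \<open>x\<close> and \<open>1 - x\<close>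
  are at least 1/4, so each factor is at least \<open>exp (-4)\<close>.\<close>

lemma bump_ge:
  assumes "1/4 \<le> x" "x \<le> 3/4"
  shows "exp (-8) \<le> bump x"
proof -
  have "exp (- 8) = exp (- 4) * exp (- 4::real)" by (simp flip: exp_add)
  also have "\<dots> \<le> exp (- 1 / x) * exp (- 1 / (1 - x))"
    using assms by (intro mult_mono) (auto simp: field_simps)
  finally show ?thesis using assms by (simp add: bump_def flat_1)
qed

subsection \<open>Weak derivatives\<close>

lemma continuous_imp_locally_integrable:
  assumes "continuous_on UNIV f"
  shows "locally_integrable f"
  unfolding locally_integrable_def set_integrable_def
proof (intro allI impI)
  fix K :: "real set" assume "compact K"
  then have "integrable lborel (\<lambda>x. indicator K x *\<^sub>R f x)"
    using assms by (intro borel_integrable_compact) (auto intro: continuous_on_subset)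
  then show "integrable lebesgue (\<lambda>x. indicator K x *\<^sub>R f x)"
    by (simp add: integrable_completion)
qed

text \<open>The continuous factor is bounded on \<open>{a..b}\<close>, where \<open>u\<close> is
  integrable. Pairings with test functions can therefore be split linearly.\<close>

lemma integrable_mult_compact_support:
  assumes u: "locally_integrable u"
    and \<phi>: "continuous_on UNIV \<phi>" "\<And>x. x \<notin> {a..b} \<Longrightarrow> \<phi> x = 0"
  shows "integrable lebesgue (\<lambda>x. u x * \<phi> x)"
proof -
  have i: "integrable lebesgue (\<lambda>x. indicator {a..b} x *\<^sub>R u x)"
    using u by (simp add: locally_integrable_def set_integrable_def)
  have m: "\<phi> \<in> borel_measurable lebesgue"
    using \<phi>(1) by (simp add: borel_measurable_continuous_onI measurable_completion)
  have "bounded (\<phi> ` {a..b})"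
    using \<phi>(1) by (intro compact_imp_bounded compact_continuous_image) (auto intro: continuous_on_subset)
  then obtain M where M: "\<And>x. x \<in> {a..b} \<Longrightarrow> norm (\<phi> x) \<le> M"
    unfolding bounded_iff by blast
  have eq: "u x * \<phi> x = (indicator {a..b} x *\<^sub>R u x) * \<phi> x" for x
    using \<phi>(2)[of x] by (auto simp: indicator_def)
  show ?thesis
    unfolding eq
  proof (rule Bochner_Integration.integrable_bound)
    show "integrable lebesgue (\<lambda>x. of_real M * (indicator {a..b} x *\<^sub>R u x))"
      using i by (rule integrable_mult_right)
    show "(\<lambda>x. indicator {a..b} x *\<^sub>R u x * \<phi> x) \<in> borel_measurable lebesgue"
      using i m by (intro borel_measurable_times) auto
    have "norm (u x) * norm (\<phi> x) \<le> \<bar>M\<bar> * norm (u x)" if "x \<in> {a..b}" for x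
      using M[OF that] by (subst mult.commute) (intro mult_right_mono, auto)
    then show "AE x in lebesgue. norm (indicator {a..b} x *\<^sub>R u x * \<phi> x)
        \<le> norm (of_real M * (indicator {a..b} x *\<^sub>R u x))"
      by (auto simp: indicator_def norm_mult)
  qed
qed

lemma integral_by_parts_compact_support:
  fixes f g f' g' :: "real \<Rightarrow> complex"
  assumes f: "\<And>x. (f has_vector_derivative f' x) (at x)" "continuous_on UNIV f'"
    and g: "\<And>x. (g has_vector_derivative g' x) (at x)" "continuous_on UNIV g'"
    and "a \<le> b" and z: "\<And>x. x \<notin> {a..b} \<Longrightarrow> g x = 0" "\<And>x. x \<notin> {a..b} \<Longrightarrow> g' x = 0"
  shows "(LINT x|lebesgue. f x * g' x) = - (LINT x|lebesgue. f' x * g x)"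
proof -
  have cf: "continuous_on UNIV f" and cg: "continuous_on UNIV g"
    using f g by (auto intro!: continuous_at_imp_continuous_on has_vector_derivative_continuous)
  have i1: "integrable lebesgue (\<lambda>x. f x * g' x)"
    using cf g z by (intro integrable_mult_compact_support[of _ _ a b] continuous_imp_locally_integrable) auto
  have i2: "integrable lebesgue (\<lambda>x. f' x * g x)"
    using f cg z by (intro integrable_mult_compact_support[of _ _ a b] continuous_imp_locally_integrable) auto
  have cont: "continuous_on A (\<lambda>x. f x * g' x + f' x * g x)" for A
    using cf cg f(2) g(2) by (intro continuous_intros) (auto intro: continuous_on_subset)
  \<comment> \<open>The interval is enlarged by 1 on each side so that both boundary terms vanish
    directly by the assumption on \<open>g\<close>.\<close>
  have "has_bochner_integral lborel
      (\<lambda>x. indicator {a - 1..b + 1} x *\<^sub>R (f x * g' x + f' x * g x))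
      (f (b + 1) * g (b + 1) - f (a - 1) * g (a - 1))"
  proof (rule has_bochner_integral_FTC_Icc)
    fix x
    show "((\<lambda>x. f x * g x) has_vector_derivative f x * g' x + f' x * g x)
        (at x within {a - 1..b + 1})"
      using has_vector_derivative_mult[OF f(1)[of x] g(1)[of x]]
      by (rule has_vector_derivative_at_within)
  qed (use \<open>a \<le> b\<close> cont in auto)
  moreover have "indicator {a - 1..b + 1} x *\<^sub>R (f x * g' x + f' x * g x) = f x * g' x + f' x * g x" for x
    using z[of x] by (auto simp: indicator_def)
  ultimately have "(LINT x|lborel. f x * g' x + f' x * g x) = 0"
    using z by (simp add: has_bochner_integral_iff)
  then have "(LINT x|lebesgue. f x * g' x + f' x * g x) = 0"
    using borel_measurable_continuous_onI[OF cont] by (simp add: integral_completion)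
  with i1 i2 show ?thesis by (simp add: add_eq_0_iff2)
qed

text \<open>Integration by parts \<open>\<tau>\<close> times; the compact support of the test
  function removes all boundary terms.\<close>

lemma smooth_has_weak_deriv:
  assumes f: "smooth_fun f"
  shows "has_weak_deriv \<tau> f (iter_deriv \<tau> f)"
  unfolding has_weak_deriv_def
proof (intro conjI ballI)
  show "locally_integrable f" "locally_integrable (iter_deriv \<tau> f)"
    using smooth_continuous_on[OF f] smooth_continuous_on[OF f, of _ 0]
    by (auto intro: continuous_imp_locally_integrable)
  fix \<phi> assume "\<phi> \<in> test_functions"
  then obtain a b where \<phi>: "smooth_fun \<phi>" "a \<le> b" "\<And>x. x \<notin> {a..b} \<Longrightarrow> \<phi> x = 0"
    by (elim test_functionsE) blast
  \<comment> \<open>Here \<open>j\<close> derivatives have moved to \<open>f\<close> and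
    \<open>k\<close> remain on \<open>\<phi>\<close>. The induction on \<open>j\<close> needs
    \<open>k\<close> arbitrary; the claim is the case \<open>k = 0\<close>.\<close>
  have "(LINT x|lebesgue. f x * iter_deriv (j + k) \<phi> x) =
      (-1) ^ j * (LINT x|lebesgue. iter_deriv j f x * iter_deriv k \<phi> x)" for j k
  proof (induction j arbitrary: k)
    case (Suc j)
    have "(LINT x|lebesgue. iter_deriv j f x * iter_deriv (Suc k) \<phi> x)
        = - (LINT x|lebesgue. iter_deriv (Suc j) f x * iter_deriv k \<phi> x)"
      by (rule integral_by_parts_compact_support[of _ _ _ _ a b])
        (use f \<phi> in \<open>auto intro: smooth_has_deriv smooth_continuous_on iter_deriv_zero_outside[of _ a b]\<close>)
    with Suc[of "Suc k"] show ?case by simp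
  qed simp
  from this[of \<tau> 0]
  show "(LINT x|lebesgue. f x * iter_deriv \<tau> \<phi> x) =
      (-1) ^ \<tau> * (LINT x|lebesgue. iter_deriv \<tau> f x * \<phi> x)"
    by simp
qed

section \<open>Uniqueness of weak derivatives\<close>

text \<open>The vanishing of the integral passes from intervals to Borel sets by induction on their
  generation, then to Lebesgue sets, and an integrable function is determined almost everywhere by
  its integrals over these.\<close>

lemma integral_intervals_zero_imp_AE_zero:
  fixes v :: "real \<Rightarrow> complex"
  assumes v: "integrable lebesgue v"
    and zero: "\<And>a b. a \<le> b \<Longrightarrow> (LINT x:{a..b}|lebesgue. v x) = 0"
  shows "AE x in lebesgue. v x = 0"
proof -
  have si: "set_integrable lebesgue A v" if "A \<in> sets lebesgue" for A
    using v that by (simp add: set_integrable_def integrable_mult_indicator)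
  \<comment> \<open>The integral over the whole line is obtained as a limit; complements are handled
    by subtracting from it.\<close>
  have I: "(\<lambda>n. LINT x:{- real n..real n}|lebesgue. v x) \<longlonglongrightarrow>
      (LINT x:(\<Union>n. {- real n..real n})|lebesgue. v x)"
    by (rule set_integral_cont_up) (auto intro!: si incseq_def[THEN iffD2])
  have U: "(\<Union>n. {- real n..real n}) = UNIV"
  proof (rule UNIV_eq_I[symmetric])
    fix x :: real
    obtain n where "\<bar>x\<bar> \<le> real n" using real_arch_simple by blast
    then show "x \<in> (\<Union>n. {- real n..real n})" by (auto simp: abs_le_iff intro!: exI[of _ n])
  qed
  have tot: "(LINT x:UNIV|lebesgue. v x) = 0"
    using I by (simp add: U zero LIMSEQ_const_iff)
  have borel: "(LINT x:A|lebesgue. v x) = 0" if "A \<in> sets borel" for A :: "real set"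
    using that
  proof (induction A rule: borel_set_induct)
    case (compl A)
    then have "A \<in> sets lebesgue" "- A \<in> sets lebesgue" by auto
    then have "(LINT x:A \<union> - A|lebesgue. v x) = (LINT x:A|lebesgue. v x) + (LINT x:-A|lebesgue. v x)"
      by (intro set_integral_Un si) auto
    with compl tot show ?case by simp
  next
    case (union F)
    then have m: "F i \<in> sets lebesgue" for i by auto
    have "(LINT x:(\<Union>i. F i)|lebesgue. v x) = (\<Sum>i. LINT x:F i|lebesgue. v x)"
      by (rule lebesgue_integral_countable_add)
        (use m union(1) in \<open>auto simp: disjoint_family_on_def intro!: si\<close>)
    with union show ?case by simp
  qed (use zero in \<open>auto simp: set_lebesgue_integral_def\<close>)
  have leb: "(LINT x:A|lebesgue. v x) = 0" if A: "A \<in> sets lebesgue" for A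
  proof -
    \<comment> \<open>A Lebesgue set is a Borel set up to a null set.\<close>
    let ?B = "main_part lborel A"
    have B: "?B \<in> sets borel" using A main_part_sets by fastforce
    then have B': "?B \<in> sets lebesgue" by auto
    have "AE x in lebesgue. x \<notin> null_part lborel A"
      using null_part_null_sets[OF A] by (rule AE_not_in)
    moreover have "?B \<union> null_part lborel A = A" using A main_part_null_part_Un by blast
    ultimately have "AE x in lebesgue. indicator A x *\<^sub>R v x = indicator ?B x *\<^sub>R v x"
      by (auto simp: indicator_def)
    then have "(LINT x:A|lebesgue. v x) = (LINT x:?B|lebesgue. v x)"
      unfolding set_lebesgue_integral_def
      using A B' v by (intro integral_cong_AE) (auto intro!: borel_measurable_scaleR)
    with borel[OF B] show ?thesis by simp
  qed
  \<comment> \<open>Uniqueness of densities is available for real functions, hence the split into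
    real and imaginary parts.\<close>
  have "AE x in lebesgue. Re (v x) = 0" and "AE x in lebesgue. Im (v x) = 0"
  proof -
    have *: "(LINT x:A|lebesgue. Re (v x)) = Re (LINT x:A|lebesgue. v x)"
      "(LINT x:A|lebesgue. Im (v x)) = Im (LINT x:A|lebesgue. v x)" if "A \<in> sets lebesgue" for A
      using si[OF that] by (simp_all add: set_lebesgue_integral_def set_integrable_def flip: integral_Re integral_Im)
    show "AE x in lebesgue. Re (v x) = 0" "AE x in lebesgue. Im (v x) = 0"
      using v leb * by (auto intro!: density_unique_real simp: set_lebesgue_integral_def)
  qed
  then show ?thesis by eventually_elim (simp add: complex_eq_iff)
qed

text \<open>Indicators of intervals are bounded pointwise limits of test functions, so dominated
  convergence makes all integrals of \<open>u\<close> over intervals vanish.\<close>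

lemma fundamental_lemma_calculus_of_variations:
  assumes u: "locally_integrable u"
    and zero: "\<And>\<phi>. \<phi> \<in> test_functions \<Longrightarrow> (LINT x|lebesgue. u x * \<phi> x) = 0"
  shows "AE x in lebesgue. u x = 0"
proof -
  have int: "set_integrable lebesgue {a..b} u" for a b
    using u by (simp add: locally_integrable_def)
  have intv: "(LINT x:{a..b}|lebesgue. u x) = 0" for a b
  proof -
    \<comment> \<open>Since \<open>exp (- 1 / (k * t))\<close> tends to 1 for \<open>t > 0\<close>, these tend boundedly to the indicator of the interval.\<close>
    define \<phi> :: "nat \<Rightarrow> real \<Rightarrow> complex" where
      "\<phi> k x = of_real (flat 1 (real k * (x - a))) * of_real (flat 1 (real k * (b - x)))" for k x
    have \<phi>0: "\<phi> k x = 0" if "x \<notin> {a<..<b}" for k x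
      using that by (auto simp: \<phi>_def flat_1 zero_less_mult_iff)
    have test: "\<phi> k \<in> test_functions" for k
    proof (rule test_functionsI)
      have "smooth_fun (\<lambda>x. of_real (flat 1 (real k * x + (- real k * a))) *
          of_real (flat 1 (- real k * x + real k * b)))"
        by (rule smooth_mult smooth_affine smooth_flat)+
      moreover have "\<phi> k = (\<lambda>x. of_real (flat 1 (real k * x + (- real k * a))) *
          of_real (flat 1 (- real k * x + real k * b)))"
        by (simp add: \<phi>_def algebra_simps fun_eq_iff)
      ultimately show "smooth_fun (\<phi> k)" by simp
    next
      fix x assume "x \<notin> {a..b}"
      then show "\<phi> k x = 0" by (intro \<phi>0) auto
    qed
    have lim1: "(\<lambda>k. flat 1 (real k * t)) \<longlonglongrightarrow> 1" if "t > 0" for t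
    proof -
      have "(\<lambda>k. - (1 / t) * (1 / real k)) \<longlonglongrightarrow> - (1 / t) * 0"
        by (intro tendsto_mult tendsto_const lim_1_over_n)
      then have "(\<lambda>k. exp (- (1 / t) * (1 / real k))) \<longlonglongrightarrow> exp 0"
        by (intro tendsto_exp) simp
      then have "(\<lambda>k. exp (- (1 / t) * (1 / real k))) \<longlonglongrightarrow> 1" by simp
      then show ?thesis
        by (rule Lim_transform_eventually)
          (use that in \<open>auto simp: flat_1 field_simps intro!: eventually_mono[OF eventually_gt_at_top[of 0]]\<close>)
    qed
    have \<phi>_lim: "(\<lambda>k. \<phi> k x) \<longlonglongrightarrow> indicator {a<..<b} x" for x
    proof (cases "x \<in> {a<..<b}")
      case True
      then have "(\<lambda>k. \<phi> k x) \<longlonglongrightarrow> of_real 1 * of_real 1"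
        unfolding \<phi>_def by (intro tendsto_mult tendsto_of_real lim1) auto
      with True show ?thesis by simp
    qed (simp add: \<phi>0)
    have int_open: "integrable lebesgue (\<lambda>x. u x * indicator {a<..<b} x)"
    proof -
      have "set_integrable lebesgue {a<..<b} u"
        by (rule set_integrable_subset[OF int[of a b]]) auto
      then have "integrable lebesgue (\<lambda>x. indicator {a<..<b} x *\<^sub>R u x)"
        by (simp add: set_integrable_def)
      then show ?thesis
        by (rule back_subst[of "integrable lebesgue"]) (auto simp: indicator_def)
    qed
    have "(\<lambda>k. LINT x|lebesgue. u x * \<phi> k x) \<longlonglongrightarrow> (LINT x|lebesgue. u x * indicator {a<..<b} x)"
    proof (rule integral_dominated_convergence)
      show "integrable lebesgue (\<lambda>x. norm (indicator {a..b} x *\<^sub>R u x))"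
        using int[of a b] unfolding set_integrable_def by (rule integrable_norm)
      show "(\<lambda>x. u x * indicator {a<..<b} x) \<in> borel_measurable lebesgue"
        using int_open by (rule borel_measurable_integrable)
      fix k
      obtain c d where "smooth_fun (\<phi> k)" "\<And>x. x \<notin> {c..d} \<Longrightarrow> \<phi> k x = 0"
        using test[of k] by (elim test_functionsE) blast
      then have "integrable lebesgue (\<lambda>x. u x * \<phi> k x)"
        by (intro integrable_mult_compact_support[OF u]) (use smooth_continuous_on[of "\<phi> k" _ 0] in auto)
      then show "(\<lambda>x. u x * \<phi> k x) \<in> borel_measurable lebesgue" by auto
      have "norm (\<phi> k x) \<le> 1 * 1" for x
        unfolding \<phi>_def norm_mult norm_of_real
        by (intro mult_mono) (use flat_1_bounds in auto)
      then show "AE x in lebesgue. norm (u x * \<phi> k x) \<le> norm (indicator {a..b} x *\<^sub>R u x)"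
        using \<phi>0 by (auto simp: norm_mult indicator_def mult_left_le)
    qed (use \<phi>_lim in \<open>auto intro!: tendsto_mult\<close>)
    then have "(LINT x|lebesgue. u x * indicator {a<..<b} x) = 0"
      using zero[OF test] by (simp add: LIMSEQ_const_iff)
    \<comment> \<open>The functions \<open>\<phi> k\<close> are 0 at \<open>a\<close> and
      \<open>b\<close>, so the limit sees the open interval; the two end points form a null
      set.\<close>
    moreover have "(LINT x|lebesgue. u x * indicator {a<..<b} x) = (LINT x:{a..b}|lebesgue. u x)"
    proof -
      have "negligible {a, b}" by simp
      then have "AE x in lebesgue. x \<notin> {a, b}"
        by (metis AE_not_in negligible_iff_null_sets)
      then have AE: "AE x in lebesgue. u x * indicator {a<..<b} x = indicator {a..b} x *\<^sub>R u x"
        by (auto simp: indicator_def)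
      have "integrable lebesgue (\<lambda>x. indicator {a..b} x *\<^sub>R u x)"
        using int by (simp add: set_integrable_def)
      then show ?thesis
        unfolding set_lebesgue_integral_def
        using AE int_open by (intro integral_cong_AE borel_measurable_integrable)
    qed
    ultimately show ?thesis by simp
  qed
  \<comment> \<open>Local integrability does not make \<open>u\<close> integrable on the line, so
    the preceding lemma is applied to truncations, and countably many null sets are
    combined.\<close>
  have "AE x in lebesgue. indicator {- real N..real N} x *\<^sub>R u x = 0" for N
  proof (rule integral_intervals_zero_imp_AE_zero)
    show "integrable lebesgue (\<lambda>x. indicator {- real N..real N} x *\<^sub>R u x)"
      using int by (simp add: set_integrable_def)
    fix a b :: real
    have "(LINT x:{a..b}|lebesgue. indicator {- real N..real N} x *\<^sub>R u x)
        = (LINT x:{max a (- real N)..min b (real N)}|lebesgue. u x)"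
      unfolding set_lebesgue_integral_def
      by (intro Bochner_Integration.integral_cong) (auto simp: indicator_def)
    then show "(LINT x:{a..b}|lebesgue. indicator {- real N..real N} x *\<^sub>R u x) = 0"
      by (simp add: intv)
  qed
  then have "AE x in lebesgue. \<forall>N. indicator {- real N..real N} x *\<^sub>R u x = 0"
    by (subst AE_all_countable) blast
  then show ?thesis
  proof eventually_elim
    fix x assume *: "\<forall>N. indicator {- real N..real N} x *\<^sub>R u x = 0"
    obtain N where "\<bar>x\<bar> \<le> real N" using real_arch_simple by blast
    then show "u x = 0" using *[rule_format, of N] by (auto simp: abs_le_iff indicator_def split: if_splits)
  qed
qed

text \<open>The difference of two weak derivatives of the same order annihilates every test
  function.\<close>

lemma has_weak_deriv_unique:
  assumes g: "has_weak_deriv \<tau> f g" and h: "has_weak_deriv \<tau> f h"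
  shows "AE x in lebesgue. g x = h x"
proof -
  have "AE x in lebesgue. g x - h x = 0"
  proof (rule fundamental_lemma_calculus_of_variations)
    have lg: "locally_integrable g" and lh: "locally_integrable h"
      using g h by (auto simp: has_weak_deriv_def)
    then show "locally_integrable (\<lambda>x. g x - h x)"
      by (auto simp: locally_integrable_def intro!: set_integral_diff)
    fix \<phi> assume \<phi>: "\<phi> \<in> test_functions"
    then obtain a b where ab: "smooth_fun \<phi>" "\<And>x. x \<notin> {a..b} \<Longrightarrow> \<phi> x = 0"
      by (elim test_functionsE) blast
    have "continuous_on UNIV \<phi>" using smooth_continuous_on[OF ab(1), of _ 0] by simp
    then have "integrable lebesgue (\<lambda>x. g x * \<phi> x)" "integrable lebesgue (\<lambda>x. h x * \<phi> x)"
      using ab(2) lg lh by (auto intro: integrable_mult_compact_support[of _ _ a b])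
    moreover have "(-1) ^ \<tau> * (LINT x|lebesgue. g x * \<phi> x) = (-1) ^ \<tau> * (LINT x|lebesgue. h x * \<phi> x)"
      using g h \<phi> by (simp add: has_weak_deriv_def)
    ultimately show "(LINT x|lebesgue. (g x - h x) * \<phi> x) = 0"
      by (simp add: left_diff_distrib)
  qed
  then show ?thesis by simp
qed

text \<open>Whatever function the choice operator in \<open>weak_deriv\<close> picks, it may be
  replaced by the classical derivative under integrals.\<close>

lemma weak_deriv_smooth:
  assumes "smooth_fun f"
  shows "AE x in lebesgue. weak_deriv \<tau> f x = iter_deriv \<tau> f x"
  unfolding weak_deriv_def
  using smooth_has_weak_deriv[OF assms] by (metis has_weak_deriv_unique someI)

text \<open>Two continuous functions differ on an open set, and an open negligible set is empty.
  Point evaluations of a continuous function are thus its actual values.\<close>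

lemma cont_rep_continuous:
  assumes "continuous_on UNIV f"
  shows "cont_rep f = f"
proof -
  let ?P = "\<lambda>g. continuous_on UNIV g \<and> (AE x in lebesgue. f x = g x)"
  have "?P (cont_rep f)"
    unfolding cont_rep_def by (rule someI[of ?P f]) (use assms in simp)
  then have c: "continuous_on UNIV (cont_rep f)" and AE: "AE x in lebesgue. f x = cont_rep f x"
    by auto
  have "negligible {x. f x \<noteq> cont_rep f x}"
    using AE by (simp add: negligible_iff_null_sets completion.AE_iff_null_sets AE_iff_null_sets)
  moreover have "open {x. f x \<noteq> cont_rep f x}"
    using assms c by (intro open_Collect_neq)
  ultimately have "{x. f x \<noteq> cont_rep f x} = {}"
    using open_not_negligible by blast
  then show ?thesis by auto
qed

subsection \<open>Fooling functions\<close>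

text \<open>A node lies in the interior of at most one cell, so \<open>n\<close> nodes spoil at most
  \<open>n\<close> of the \<open>2 * n\<close> cells. Cell \<open>i\<close> is rescaled to the unit
  interval.\<close>

lemma node_free_cells:
  fixes x :: "nat \<Rightarrow> real"
  assumes "n \<ge> 1"
  obtains S where "S \<subseteq> {..<2 * n}" "n \<le> card S"
    "\<And>i j. i \<in> S \<Longrightarrow> j \<in> {1..n} \<Longrightarrow> real (2 * n) * x j - real i \<notin> {0<..<1}"
proof
  let ?hit = "\<lambda>i. \<exists>j\<in>{1..n}. real (2 * n) * x j - real i \<in> {0<..<1}"
  let ?S = "{i. i < 2 * n \<and> \<not> ?hit i}"
  show "?S \<subseteq> {..<2 * n}" by auto
  show "real (2 * n) * x j - real i \<notin> {0<..<1}" if "i \<in> ?S" "j \<in> {1..n}" for i j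
    using that by blast
  \<comment> \<open>The floor names the only cell a node can hit. For nodes left of 0 the truncation
    by \<open>nat\<close> is harmless, since only an inclusion is claimed.\<close>
  have "{i. i < 2 * n \<and> ?hit i} \<subseteq> (\<lambda>j. nat \<lfloor>real (2 * n) * x j\<rfloor>) ` {1..n}"
  proof (clarify)
    fix i j assume "i < 2 * n" "j \<in> {1..n}" and *: "real (2 * n) * x j - real i \<in> {0<..<1}"
    from * have "\<lfloor>real (2 * n) * x j\<rfloor> = int i" by (intro floor_unique) auto
    with \<open>j \<in> {1..n}\<close> show "i \<in> (\<lambda>j. nat \<lfloor>real (2 * n) * x j\<rfloor>) ` {1..n}" by force
  qed
  from surj_card_le[OF _ this] have "card {i. i < 2 * n \<and> ?hit i} \<le> n"
    by simp
  moreover have "card (?S \<union> {i. i < 2 * n \<and> ?hit i}) \<le> card ?S + card {i. i < 2 * n \<and> ?hit i}"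
    by (rule card_Un_le)
  moreover have "?S \<union> {i. i < 2 * n \<and> ?hit i} = {..<2 * n}" by blast
  then have "card (?S \<union> {i. i < 2 * n \<and> ?hit i}) = 2 * n" by (simp only: card_lessThan)
  ultimately show "n \<le> card ?S" by linarith
qed

text \<open>Summand \<open>i\<close> is the bump rescaled to the cell from \<open>i / N\<close> to
  \<open>(i + 1) / N\<close>; its height does not depend on \<open>N\<close>.\<close>

definition bump_sum :: "nat \<Rightarrow> nat set \<Rightarrow> real \<Rightarrow> real" where
  "bump_sum N S x = (\<Sum>i\<in>S. bump (real N * x - real i))"

lemma smooth_bump_sum: "smooth_fun (\<lambda>x. of_real (bump_sum N S x))"
proof -
  have "smooth_fun (\<lambda>x. of_real (bump (real N * x + - real i)))" for i
    by (rule smooth_affine[OF smooth_bump])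
  then show ?thesis
    using smooth_sum[of S "\<lambda>i x. of_real (bump (real N * x - real i))"] by (simp add: bump_sum_def)
qed

lemma bump_sum_eq_0:
  assumes "\<And>i. i \<in> S \<Longrightarrow> real N * x - real i \<notin> {0<..<1}"
  shows "bump_sum N S x = 0"
  unfolding bump_sum_def using assms bump_eq_0 by (intro sum.neutral) blast

lemma bump_sum_outside:
  assumes "S \<subseteq> {..<N}" "x \<notin> {0..1}"
  shows "bump_sum N S x = 0"
proof (rule bump_sum_eq_0)
  fix i assume "i \<in> S"
  then have i: "real i + 1 \<le> real N" using assms(1) by auto
  consider "x < 0" | "x > 1" using assms(2) by fastforce
  then show "real N * x - real i \<notin> {0<..<1}"
  proof cases
    case 1
    then have "real N * x \<le> 0" by (simp add: mult_nonneg_nonpos)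
    then show ?thesis by auto
  next
    case 2
    then have "real N \<le> real N * x" using mult_left_mono[of 1 x "real N"] by simp
    with i have "1 \<le> real N * x - real i" by linarith
    then show ?thesis by simp
  qed
qed

lemma iter_deriv_bump_bounded:
  obtains M where "M \<ge> 0" "\<And>x. cmod (iter_deriv \<tau> (\<lambda>x. of_real (bump x)) x) \<le> M"
proof -
  let ?g = "iter_deriv \<tau> (\<lambda>x. of_real (bump x))"
  have "bounded (?g ` {0..1})"
    by (intro compact_imp_bounded compact_continuous_image smooth_continuous_on smooth_bump) auto
  then obtain M where M: "\<And>x. x \<in> {0..1} \<Longrightarrow> cmod (?g x) \<le> M"
    unfolding bounded_iff by blast
  show thesis
  proof (rule that[of "\<bar>M\<bar>"])
    fix x
    show "cmod (?g x) \<le> \<bar>M\<bar>"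
    proof (cases "x \<in> {0..1}")
      case False
      have "?g x = 0"
        by (rule iter_deriv_zero_outside[OF smooth_bump _ False]) (auto intro: bump_eq_0)
      then show ?thesis by simp
    qed (use M[of x] in simp)
  qed simp
qed

text \<open>At each point at most one bump contributes, so the bound does not grow with the number
  of cells; each differentiation costs a factor \<open>N\<close>.\<close>

lemma iter_deriv_bump_sum_le:
  assumes M: "M \<ge> 0" "\<And>x. cmod (iter_deriv \<tau> (\<lambda>x. of_real (bump x)) x) \<le> M"
    and S: "S \<subseteq> {..<N}"
  shows "cmod (iter_deriv \<tau> (\<lambda>x. of_real (bump_sum N S x)) x) \<le> real N ^ \<tau> * M * indicator {0..1} x"
proof (cases "x \<in> {0..1}")
  case False
  have "iter_deriv \<tau> (\<lambda>x. of_real (bump_sum N S x)) x = (0::complex)"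
    by (rule iter_deriv_zero_outside[OF smooth_bump_sum _ False]) (use bump_sum_outside[OF S] in auto)
  with False show ?thesis by simp
next
  case True
  let ?g = "iter_deriv \<tau> (\<lambda>x. complex_of_real (bump x))"
  let ?k = "nat \<lfloor>real N * x\<rfloor>"
  have fin: "finite S" using S finite_subset by blast
  \<comment> \<open>Continuity extends the vanishing of the derivative to the end points 0 and 1,
    where neighbouring cells meet.\<close>
  have g0: "?g t = 0" if "t \<notin> {0<..<1}" for t
  proof -
    have out: "?g t = 0" if "t \<notin> {0..1}" for t
      by (rule iter_deriv_zero_outside[OF smooth_bump _ that]) (auto intro: bump_eq_0)
    have c: "continuous_on UNIV ?g" by (rule smooth_continuous_on[OF smooth_bump])
    then have "closed {t. ?g t = 0}" by (intro closed_Collect_eq continuous_intros)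
    moreover have "- {0..1} \<subseteq> {t. ?g t = 0}" using out by auto
    ultimately have "closure (- {0..1}) \<subseteq> {t. ?g t = 0}" by (rule closure_minimal[rotated])
    moreover have "closure (- {0..1::real}) = - {0<..<1}"
      by (simp add: closure_complement)
    ultimately show ?thesis using that by auto
  qed
  have "iter_deriv \<tau> (\<lambda>x. of_real (bump_sum N S x)) x
      = (\<Sum>i\<in>S. of_real (real N ^ \<tau>) * ?g (real N * x - real i))"
  proof -
    have 1: "smooth_fun (\<lambda>x. of_real (bump (real N * x + - real i)))" for i
      by (rule smooth_affine[OF smooth_bump])
    have "iter_deriv \<tau> (\<lambda>x. \<Sum>i\<in>S. of_real (bump (real N * x + - real i))) x
       = (\<Sum>i\<in>S. of_real (real N ^ \<tau>) * ?g (real N * x + - real i))"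
      unfolding iter_deriv_sum[OF 1]
      by (intro sum.cong refl fun_cong[OF iter_deriv_affine[OF smooth_bump]])
    then show ?thesis by (simp add: bump_sum_def)
  qed
  \<comment> \<open>Only the cell with index \<open>?k\<close> can contain \<open>x\<close> in its
    interior. The intersection covers the case that \<open>?k\<close> is not in \<open>S\<close>, as
    for \<open>x = 1\<close>.\<close>
  also have "\<dots> = (\<Sum>i\<in>S \<inter> {?k}. of_real (real N ^ \<tau>) * ?g (real N * x - real i))"
  proof (rule sum.mono_neutral_right[OF fin])
    show "\<forall>i\<in>S - S \<inter> {?k}. of_real (real N ^ \<tau>) * ?g (real N * x - real i) = 0"
    proof
      fix i assume "i \<in> S - S \<inter> {?k}"
      then have "i \<noteq> ?k" by blast
      then have "real N * x - real i \<notin> {0<..<1}"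
        using floor_unique[of "int i" "real N * x"] by auto
      then show "of_real (real N ^ \<tau>) * ?g (real N * x - real i) = 0" using g0 by simp
    qed
  qed auto
  also have "cmod \<dots> \<le> (\<Sum>i\<in>S \<inter> {?k}. real N ^ \<tau> * M)"
    by (rule sum_norm_le) (use M in \<open>auto simp: norm_mult norm_power intro!: mult_left_mono\<close>)
  also have "\<dots> \<le> (\<Sum>i\<in>{?k}. real N ^ \<tau> * M)"
    by (rule sum_mono2) (use M in auto)
  finally show ?thesis using True by simp
qed

text \<open>The integrand dominates a step function of height \<open>r * exp (-8)\<close> on the
  middle halves of the chosen cells, each of length \<open>1 / (2 * N)\<close>.\<close>

lemma bump_sum_integral_ge:
  assumes S: "S \<subseteq> {..<N}" and r: "0 \<le> r" "\<And>x. x \<in> {0..1} \<Longrightarrow> r \<le> \<rho> x"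
    and \<rho>: "continuous_on UNIV \<rho>"
  shows "integrable lebesgue (\<lambda>x. bump_sum N S x * \<rho> x)"
    and "r * exp (-8) / 2 * (real (card S) / real N) \<le> (LINT x|lebesgue. bump_sum N S x * \<rho> x)"
proof -
  have "continuous_on UNIV (\<lambda>x. complex_of_real (bump_sum N S x))"
    using smooth_continuous_on[OF smooth_bump_sum, of _ 0] by simp
  \<comment> \<open>The detour through complex values is made because
    \<open>locally_integrable\<close> concerns complex functions.\<close>
  then have "integrable lebesgue (\<lambda>x. complex_of_real (\<rho> x) * complex_of_real (bump_sum N S x))"
    using \<rho> bump_sum_outside[OF S]
    by (intro integrable_mult_compact_support[of _ _ 0 1] continuous_imp_locally_integrable
        continuous_intros) auto
  then have "integrable lebesgue (\<lambda>x. complex_of_real (bump_sum N S x * \<rho> x))"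
    by (simp add: mult.commute)
  then show int: "integrable lebesgue (\<lambda>x. bump_sum N S x * \<rho> x)"
    by (simp only: complex_of_real_integrable_eq)
  let ?I = "\<lambda>i::nat. {(real i + 1/4) / real N..(real i + 3/4) / real N}"
  have fin: "finite S" using S finite_subset by blast
  have int_I: "integrable lebesgue (\<lambda>x. r * exp (-8) * indicator (?I i) x)" for i
    by (intro integrable_mult_right integrable_real_indicator) (auto simp: emeasure_lborel_Icc_eq)
  have "(LINT x|lebesgue. (\<Sum>i\<in>S. r * exp (-8) * indicator (?I i) x))
      = (\<Sum>i\<in>S. LINT x|lebesgue. r * exp (-8) * indicator (?I i) x)"
    by (rule Bochner_Integration.integral_sum[OF int_I])
  also have "\<dots> = (\<Sum>i\<in>S. r * exp (-8) * measure lebesgue (?I i))"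
    by (simp only: integral_mult_right_zero) simp
  also have "\<dots> = (\<Sum>i\<in>S. r * exp (-8) / 2 / real N)"
  proof (intro sum.cong refl)
    fix i
    have "(real i + 1/4) / real N \<le> (real i + 3/4) / real N"
      by (intro divide_right_mono) auto
    then have "measure lebesgue (?I i) = (real i + 3/4) / real N - (real i + 1/4) / real N"
      by simp
    also have "\<dots> = 1 / 2 / real N"
      by (simp flip: diff_divide_distrib)
    finally show "r * exp (-8) * measure lebesgue (?I i) = r * exp (-8) / 2 / real N"
      by simp
  qed
  finally have L: "(LINT x|lebesgue. (\<Sum>i\<in>S. r * exp (-8) * indicator (?I i) x))
      = r * exp (-8) / 2 * (real (card S) / real N)"
    by simp
  have "(LINT x|lebesgue. (\<Sum>i\<in>S. r * exp (-8) * indicator (?I i) x))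
      \<le> (LINT x|lebesgue. bump_sum N S x * \<rho> x)"
  proof (rule integral_mono[OF _ int])
    show "integrable lebesgue (\<lambda>x. \<Sum>i\<in>S. r * exp (- 8) * indicator (?I i) x)"
      by (intro Bochner_Integration.integrable_sum int_I)
    fix x
    have "r * exp (-8) * indicator (?I i) x \<le> bump (real N * x - real i) * \<rho> x" if "i \<in> S" for i
    proof -
      have i: "real i + 1 \<le> real N" "real N > 0" using that S by auto
      show ?thesis
      proof (cases "x \<in> ?I i")
        case True
        then have *: "1/4 \<le> real N * x - real i" "real N * x - real i \<le> 3/4"
          using i by (auto simp: field_simps)
        have "real N * x \<le> real N * 1" using *(2) i(1) by linarith
        then have "x \<le> 1" using i(2) by (rule mult_left_le_imp_le)
        moreover have "0 \<le> (real i + 1/4) / real N" by simp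
        then have "0 \<le> x" using True by (meson atLeastAtMost_iff order_trans)
        ultimately have "r \<le> \<rho> x" by (intro r) auto
        then have "exp (-8) * r \<le> bump (real N * x - real i) * \<rho> x"
          using bump_ge[OF *] r(1) bump_nonneg by (intro mult_mono) auto
        with True show ?thesis by (simp add: mult.commute)
      next
        case False
        show ?thesis
        proof (cases "x \<in> {0..1}")
          case True
          then have "0 \<le> \<rho> x" using r order_trans by blast
          with False show ?thesis by (simp add: bump_nonneg)
        next
          \<comment> \<open>The sign of \<open>\<rho>\<close> is unknown outside the unit interval,
            so the bump itself must be 0; it is seen as a \<open>bump_sum\<close> over one
            cell.\<close>
          case F: False
          have "bump (real N * x - real i) = 0"
            using bump_sum_outside[of "{i}" N x] F that S by (auto simp: bump_sum_def)
          with False show ?thesis by simp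
        qed
      qed
    qed
    then show "(\<Sum>i\<in>S. r * exp (- 8) * indicator (?I i) x) \<le> bump_sum N S x * \<rho> x"
      unfolding bump_sum_def sum_distrib_right by (rule sum_mono)
  qed
  then show "r * exp (-8) / 2 * (real (card S) / real N) \<le> (LINT x|lebesgue. bump_sum N S x * \<rho> x)"
    by (simp add: L)
qed

section \<open>Weights and Sobolev energy on the unit interval\<close>

lemma rho_pos: "(\<And>x. poly q x > 0) \<Longrightarrow> rho q m \<kappa> x > 0"
  unfolding rho_def by (metis less_irrefl powr_gt_zero)

lemma continuous_rho:
  assumes "\<And>x. poly q x > 0"
  shows "continuous_on A (rho q m \<kappa>)"
  unfolding rho_def
  by (intro continuous_intros) (use assms in \<open>auto simp: less_imp_neq[symmetric]\<close>)

text \<open>A continuous positive function attains its extrema on a compact interval. All fooling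
  functions are supported there, so the bounds are uniform in \<open>n\<close>.\<close>

lemma rho_bounds:
  assumes "\<And>x. poly q x > 0"
  obtains r R where "0 < r" "0 \<le> R" "\<And>x. x \<in> {0..1} \<Longrightarrow> r \<le> rho q m \<kappa> x"
    "\<And>x. x \<in> {0..1} \<Longrightarrow> rho q m \<kappa> x \<le> R"
proof -
  have c: "continuous_on {0..1} (rho q m \<kappa>)" by (rule continuous_rho[OF assms])
  obtain a where a: "a \<in> {0..1}" "\<And>y. y \<in> {0..1} \<Longrightarrow> rho q m \<kappa> a \<le> rho q m \<kappa> y"
    using continuous_attains_inf[OF _ _ c] by auto
  obtain b where b: "b \<in> {0..1}" "\<And>y. y \<in> {0..1} \<Longrightarrow> rho q m \<kappa> y \<le> rho q m \<kappa> b"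
    using continuous_attains_sup[OF _ _ c] by auto
  show thesis
    by (rule that[of "rho q m \<kappa> a" "rho q m \<kappa> b"])
      (use a b rho_pos[OF assms] in \<open>auto intro: less_imp_le\<close>)
qed

lemma weighted_nn_integral_le:
  fixes g :: "real \<Rightarrow> complex"
  assumes "p > 0" "B \<ge> 0" "R \<ge> 0" "\<And>x. cmod (g x) \<le> B * indicator {0..1} x"
    "\<And>x. x \<in> {0..1} \<Longrightarrow> \<rho> x \<le> R" "\<And>x. 0 \<le> \<rho> x"
  shows "(\<integral>\<^sup>+ x. ennreal (cmod (g x) powr p * \<rho> x) \<partial>lebesgue) \<le> ennreal (B powr p * R)"
proof -
  have "(\<integral>\<^sup>+ x. ennreal (cmod (g x) powr p * \<rho> x) \<partial>lebesgue)
      \<le> (\<integral>\<^sup>+ x. ennreal (B powr p * R) * indicator {0..1::real} x \<partial>lebesgue)"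
  proof (rule nn_integral_mono)
    fix x
    show "ennreal (cmod (g x) powr p * \<rho> x) \<le> ennreal (B powr p * R) * indicator {0..1} x"
    proof (cases "x \<in> {0..1}")
      case True
      then have "cmod (g x) \<le> B" using assms(4)[of x] by simp
      with True assms show ?thesis
        by (auto intro!: ennreal_leI mult_mono powr_mono2)
    next
      case False
      then have "cmod (g x) = 0" using assms(4)[of x] by simp
      with False assms(1) show ?thesis by simp
    qed
  qed
  also have "\<dots> = ennreal (B powr p * R)"
    by (simp add: nn_integral_cmult_indicator)
  finally show ?thesis .
qed

lemma sobolev_energy_smooth:
  assumes "smooth_fun f"
  shows "sobolev_energy q m \<alpha> p \<kappa> f = (\<Sum>\<tau>=0..\<alpha>. \<integral>\<^sup>+ x. ennreal (cmod (iter_deriv \<tau> f x) powr p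
      * rho q m (\<kappa> + p * (real \<alpha> - real \<tau>)) x) \<partial>lebesgue)"
  unfolding sobolev_energy_def
proof (intro sum.cong refl nn_integral_cong_AE)
  fix \<tau>
  show "AE x in lebesgue. ennreal (cmod (weak_deriv \<tau> f x) powr p * rho q m (\<kappa> + p * (real \<alpha> - real \<tau>)) x)
      = ennreal (cmod (iter_deriv \<tau> f x) powr p * rho q m (\<kappa> + p * (real \<alpha> - real \<tau>)) x)"
    using weak_deriv_smooth[OF assms, of \<tau>] by eventually_elim simp
qed

text \<open>The left side is the summand of order 0. It yields both membership in
  \<open>weighted_Lp\<close> and positivity of the energy.\<close>

lemma nn_integral_le_sobolev_energy:
  assumes "smooth_fun f"
  shows "(\<integral>\<^sup>+ x. ennreal (cmod (f x) powr p * rho q m (\<kappa> + p * real \<alpha>) x) \<partial>lebesgue)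
    \<le> sobolev_energy q m \<alpha> p \<kappa> f"
proof -
  let ?I = "\<lambda>\<tau>. \<integral>\<^sup>+ x. ennreal (cmod (iter_deriv \<tau> f x) powr p
      * rho q m (\<kappa> + p * (real \<alpha> - real \<tau>)) x) \<partial>lebesgue"
  have "?I 0 \<le> (\<Sum>\<tau>=0..\<alpha>. ?I \<tau>)"
    by (rule member_le_sum) auto
  then show ?thesis
    by (simp only: sobolev_energy_smooth[OF assms] iter_deriv_0 of_nat_0 diff_zero)
qed

text \<open>If the energy were 0, its order 0 term would vanish, and since the weight is positive
  the function would be 0 almost everywhere.\<close>

lemma sobolev_energy_smooth_pos:
  assumes f: "smooth_fun f" "\<not> (AE x in lebesgue. f x = 0)" and q: "\<And>x. poly q x > 0"
  shows "sobolev_energy q m \<alpha> p \<kappa> f > 0"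
proof (rule ccontr)
  let ?h = "\<lambda>x. ennreal (cmod (f x) powr p * rho q m (\<kappa> + p * real \<alpha>) x)"
  assume "\<not> sobolev_energy q m \<alpha> p \<kappa> f > 0"
  then have "(\<integral>\<^sup>+ x. ?h x \<partial>lebesgue) = 0"
    using nn_integral_le_sobolev_energy[OF f(1), of p q m \<kappa> \<alpha>] by simp
  moreover have "?h \<in> borel_measurable lebesgue"
  proof -
    have "f \<in> borel_measurable borel"
      using smooth_continuous_on[OF f(1), of _ 0] by (simp add: borel_measurable_continuous_onI)
    moreover have "rho q m (\<kappa> + p * real \<alpha>) \<in> borel_measurable borel"
      by (intro borel_measurable_continuous_onI continuous_rho q)
    ultimately have "?h \<in> borel_measurable borel" by measurable
    then show ?thesis by (simp add: measurable_completion)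
  qed
  ultimately have "AE x in lebesgue. ?h x = 0"
    by (simp add: nn_integral_0_iff_AE)
  then have "AE x in lebesgue. f x = 0"
  proof eventually_elim
    fix x assume "?h x = 0"
    then have "cmod (f x) powr p * rho q m (\<kappa> + p * real \<alpha>) x \<le> 0"
      by (simp add: ennreal_eq_0_iff)
    then have "cmod (f x) powr p \<le> 0"
      using rho_pos[of q m "\<kappa> + p * real \<alpha>" x, OF q] by (simp add: mult_le_0_iff)
    then show "f x = 0" by (metis norm_eq_zero powr_gt_zero not_le)
  qed
  with f(2) show False by blast
qed

text \<open>The term of order \<open>\<tau>\<close> is of size at most
  \<open>N powr (\<tau> * p)\<close> up to a constant, and the top order dominates because
  \<open>N \<ge> 1\<close>. \<open>K\<close> is chosen before \<open>N\<close> and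
  \<open>S\<close>.\<close>

lemma bump_sum_energy_bound:
  assumes q: "\<And>x. poly q x > 0" and p: "p > 0"
  obtains K where "K > 0"
    "\<And>N S. N \<ge> 1 \<Longrightarrow> S \<subseteq> {..<N} \<Longrightarrow>
      sobolev_energy q m \<alpha> p \<kappa> (\<lambda>x. of_real (bump_sum N S x)) \<le> ennreal (K * real N powr (real \<alpha> * p))"
proof -
  let ?w = "\<lambda>\<tau>::nat. rho q m (\<kappa> + p * (real \<alpha> - real \<tau>))"
  have "\<exists>M. M \<ge> 0 \<and> (\<forall>x. cmod (iter_deriv \<tau> (\<lambda>x. of_real (bump x)) x) \<le> M)" for \<tau>
    using iter_deriv_bump_bounded[of \<tau>] by blast
  then obtain M where M: "\<And>\<tau>. M \<tau> \<ge> 0"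
    "\<And>\<tau> x. cmod (iter_deriv \<tau> (\<lambda>x. of_real (bump x)) x) \<le> M \<tau>"
    by metis
  have "\<exists>R. R \<ge> 0 \<and> (\<forall>x\<in>{0..1}. ?w \<tau> x \<le> R)" for \<tau>
    using rho_bounds[OF q, of m "\<kappa> + p * (real \<alpha> - real \<tau>)"] by metis
  then obtain R where R: "\<And>\<tau>. R \<tau> \<ge> 0" "\<And>\<tau> x. x \<in> {0..1} \<Longrightarrow> ?w \<tau> x \<le> R \<tau>"
    by metis
  \<comment> \<open>The summand 1 keeps \<open>K\<close> strictly positive, since the final constant
    divides by a power of it.\<close>
  define K where "K = 1 + (\<Sum>\<tau>=0..\<alpha>. M \<tau> powr p * R \<tau>)"
  have "K > 0"
    unfolding K_def using R by (intro add_pos_nonneg sum_nonneg mult_nonneg_nonneg) auto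
  moreover have "sobolev_energy q m \<alpha> p \<kappa> (\<lambda>x. of_real (bump_sum N S x))
      \<le> ennreal (K * real N powr (real \<alpha> * p))" if N: "N \<ge> 1" and S: "S \<subseteq> {..<N}" for N S
  proof -
    let ?f = "\<lambda>x. complex_of_real (bump_sum N S x)"
    have "(\<integral>\<^sup>+ x. ennreal (cmod (iter_deriv \<tau> ?f x) powr p * ?w \<tau> x) \<partial>lebesgue)
        \<le> ennreal (M \<tau> powr p * R \<tau> * real N powr (real \<alpha> * p))" if \<tau>: "\<tau> \<in> {0..\<alpha>}" for \<tau>
    proof -
      have "(\<integral>\<^sup>+ x. ennreal (cmod (iter_deriv \<tau> ?f x) powr p * ?w \<tau> x) \<partial>lebesgue)
          \<le> ennreal ((real N ^ \<tau> * M \<tau>) powr p * R \<tau>)"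
        using p M R iter_deriv_bump_sum_le[OF M S] rho_pos[OF q]
        by (intro weighted_nn_integral_le) (auto intro: less_imp_le)
      also have "(real N ^ \<tau> * M \<tau>) powr p * R \<tau> \<le> M \<tau> powr p * R \<tau> * real N powr (real \<alpha> * p)"
      proof -
        have "(real N ^ \<tau> * M \<tau>) powr p = real N powr (real \<tau> * p) * M \<tau> powr p"
          using N M(1)[of \<tau>] by (simp add: powr_mult powr_powr flip: powr_realpow)
        also have "\<dots> \<le> real N powr (real \<alpha> * p) * M \<tau> powr p"
          using N \<tau> p by (intro mult_right_mono powr_mono) auto
        finally have "(real N ^ \<tau> * M \<tau>) powr p * R \<tau> \<le> real N powr (real \<alpha> * p) * M \<tau> powr p * R \<tau>"
          using R(1) by (rule mult_right_mono)
        then show ?thesis by (simp add: mult_ac)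
      qed
      finally show ?thesis by (simp add: ennreal_leI)
    qed
    then have "sobolev_energy q m \<alpha> p \<kappa> ?f
        \<le> (\<Sum>\<tau>=0..\<alpha>. ennreal (M \<tau> powr p * R \<tau> * real N powr (real \<alpha> * p)))"
      unfolding sobolev_energy_smooth[OF smooth_bump_sum] by (rule sum_mono)
    also have "\<dots> = ennreal (\<Sum>\<tau>=0..\<alpha>. M \<tau> powr p * R \<tau> * real N powr (real \<alpha> * p))"
      using R by (intro sum_ennreal) auto
    also have "\<dots> \<le> ennreal (K * real N powr (real \<alpha> * p))"
      by (intro ennreal_leI) (simp add: K_def distrib_right flip: sum_distrib_right)
    finally show ?thesis .
  qed
  ultimately show thesis by (rule that)
qed

section \<open>The lower bound for arbitrary quadrature rules\<close>

theorem proposition3p9: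
  fixes q :: "real poly" and m \<alpha> :: nat and p \<upsilon> \<beta> :: real
  assumes "\<And>x. poly q x > 0" and "degree q = 2 * m" and "m \<ge> 1"
    and "1 < p" and "\<alpha> \<ge> 1"
  shows "\<exists>c>0. \<forall>n\<ge>1. \<forall>(w :: nat \<Rightarrow> real) (x :: nat \<Rightarrow> real).
     (SUP f\<in>admissible q m \<alpha> p \<beta> \<upsilon>.
        ereal (cmod (weighted_integral (rho q m \<upsilon>) f - quadrature n w x f)
               / sobolev_norm q m \<alpha> p \<beta> f))
     \<ge> ereal (c * real n powr (- real \<alpha>))"
proof -
  note q = assms(1)
  have p: "p > 0" using assms(4) by simp
  obtain r R where r: "0 < r" "0 \<le> R" "\<And>x. x \<in> {0..1} \<Longrightarrow> r \<le> rho q m \<upsilon> x"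
    "\<And>x. x \<in> {0..1} \<Longrightarrow> rho q m \<upsilon> x \<le> R"
    by (rule rho_bounds[OF q, of m \<upsilon>]) (rule that)
  obtain K where K: "K > 0" "\<And>N S. N \<ge> 1 \<Longrightarrow> S \<subseteq> {..<N} \<Longrightarrow>
      sobolev_energy q m \<alpha> p \<beta> (\<lambda>x. of_real (bump_sum N S x)) \<le> ennreal (K * real N powr (real \<alpha> * p))"
    by (rule bump_sum_energy_bound[OF q p, of m \<alpha> \<beta>]) (rule that)
  \<comment> \<open>The lower bound for the error: one factor 1/2 comes from the middle halves of
    the cells, the other from keeping at least half of the cells.\<close>
  define d where "d = r * exp (-8) / 4"
  \<comment> \<open>The denominator comes from the norm bound: the root of order \<open>p\<close> of
    \<open>K * N powr (\<alpha> * p)\<close> with \<open>N = 2 * n\<close>, without the power of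
    \<open>n\<close>.\<close>
  define c where "c = d / (K powr (1 / p) * 2 powr real \<alpha>)"
  have d: "d > 0" using r by (simp add: d_def)
  have "c > 0" using d K by (simp add: c_def)
  moreover have "ereal (c * real n powr (- real \<alpha>)) \<le>
     (SUP f\<in>admissible q m \<alpha> p \<beta> \<upsilon>.
        ereal (cmod (weighted_integral (rho q m \<upsilon>) f - quadrature n w x f)
               / sobolev_norm q m \<alpha> p \<beta> f))"
    if n: "n \<ge> 1" for n and w x :: "nat \<Rightarrow> real"
  proof -
    let ?N = "2 * n"
    obtain S where S: "S \<subseteq> {..<?N}" "n \<le> card S"
      and free: "\<And>i j. i \<in> S \<Longrightarrow> j \<in> {1..n} \<Longrightarrow> real ?N * x j - real i \<notin> {0<..<1}"
      by (rule node_free_cells[OF n, of x]) (rule that)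
    define f where "f x = complex_of_real (bump_sum ?N S x)" for x
    have sf: "smooth_fun f" unfolding f_def by (rule smooth_bump_sum)
    have cf: "continuous_on UNIV f" using smooth_continuous_on[OF sf, of _ 0] by simp
    have quad: "quadrature n w x f = 0"
      unfolding quadrature_def cont_rep_continuous[OF cf]
    proof (intro sum.neutral ballI)
      fix j assume "j \<in> {1..n}"
      then have "bump_sum ?N S (x j) = 0" by (intro bump_sum_eq_0 free)
      then show "complex_of_real (w j) * f (x j) = 0" by (simp add: f_def)
    qed
    have bint: "integrable lebesgue (\<lambda>x. bump_sum ?N S x * rho q m \<upsilon> x)"
      and "r * exp (-8) / 2 * (real (card S) / real ?N) \<le> (LINT x|lebesgue. bump_sum ?N S x * rho q m \<upsilon> x)"
      using bump_sum_integral_ge[OF S(1), of r "rho q m \<upsilon>"] r continuous_rho[OF q] by auto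
    moreover have "d \<le> r * exp (-8) / 2 * (real (card S) / real ?N)"
    proof -
      have "1 / 2 \<le> real (card S) / real ?N" using S(2) n by (simp add: field_simps)
      then have "r * exp (-8) / 2 * (1 / 2) \<le> r * exp (-8) / 2 * (real (card S) / real ?N)"
        using r by (intro mult_left_mono) auto
      then show ?thesis by (simp add: d_def)
    qed
    ultimately have ge: "d \<le> (LINT x|lebesgue. bump_sum ?N S x * rho q m \<upsilon> x)"
      by linarith
    have wi: "weighted_integral (rho q m \<upsilon>) f = of_real (LINT x|lebesgue. bump_sum ?N S x * rho q m \<upsilon> x)"
      unfolding weighted_integral_def f_def of_real_mult[symmetric] by (rule integral_complex_of_real)
    have err: "d \<le> cmod (weighted_integral (rho q m \<upsilon>) f - quadrature n w x f)"
      using ge d by (simp add: wi quad)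
    \<comment> \<open>A function vanishing almost everywhere would have weighted integral 0, against
      the lower bound \<open>d > 0\<close>.\<close>
    have nz: "\<not> (AE x in lebesgue. f x = 0)"
    proof
      assume "AE x in lebesgue. f x = 0"
      then have "AE x in lebesgue. bump_sum ?N S x * rho q m \<upsilon> x = 0"
        by eventually_elim (simp add: f_def)
      then have "(LINT x|lebesgue. bump_sum ?N S x * rho q m \<upsilon> x) = 0"
        by (rule integral_eq_zero_AE)
      with ge d show False by simp
    qed
    let ?E = "sobolev_energy q m \<alpha> p \<beta> f"
    have E: "?E \<le> ennreal (K * real ?N powr (real \<alpha> * p))"
      unfolding f_def[abs_def] by (rule K(2)[OF _ S(1)]) (use n in simp)
    have Efin: "?E < \<infinity>" using E by (rule le_less_trans) simp
    have Epos: "?E > 0" by (rule sobolev_energy_smooth_pos[OF sf nz q])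
    have adm: "f \<in> admissible q m \<alpha> p \<beta> \<upsilon>"
      unfolding admissible_def sobolev_space_def weighted_Lp_def
    proof (intro CollectI conjI allI impI nz Efin)
      show "f \<in> borel_measurable lebesgue"
        using cf by (simp add: borel_measurable_continuous_onI measurable_completion)
      have "(\<integral>\<^sup>+ x. ennreal (cmod (f x) powr p * rho q m (\<beta> + real \<alpha> * p) x) \<partial>lebesgue) \<le> ?E"
        using nn_integral_le_sobolev_energy[OF sf, of p q m \<beta> \<alpha>] by (simp only: mult.commute[of p])
      then show "(\<integral>\<^sup>+ x. ennreal (cmod (f x) powr p * rho q m (\<beta> + real \<alpha> * p) x) \<partial>lebesgue) < \<infinity>"
        using Efin by (rule le_less_trans)
      show "\<exists>g. has_weak_deriv \<tau> f g" for \<tau>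
        using smooth_has_weak_deriv[OF sf] by blast
      show "integrable lebesgue (\<lambda>x. f x * complex_of_real (rho q m \<upsilon> x))"
        unfolding f_def of_real_mult[symmetric] complex_of_real_integrable_eq by (rule bint)
    qed
    \<comment> \<open>Both bounds on the energy matter: \<open>enn2real\<close> sends infinity to 0,
      and division by a zero norm would give the quotient 0.\<close>
    have pos: "0 < sobolev_norm q m \<alpha> p \<beta> f"
      using Epos Efin by (auto simp: sobolev_norm_def enn2real_eq_0_iff)
    have "sobolev_norm q m \<alpha> p \<beta> f \<le> (K * real ?N powr (real \<alpha> * p)) powr (1 / p)"
      unfolding sobolev_norm_def using E K p
      by (intro powr_mono2 enn2real_leI) auto
    also have "\<dots> = K powr (1 / p) * real ?N powr real \<alpha>"
      using K p by (simp add: powr_mult powr_powr)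
    also have "\<dots> = K powr (1 / p) * 2 powr real \<alpha> * real n powr real \<alpha>"
      by (simp add: powr_mult)
    finally have "sobolev_norm q m \<alpha> p \<beta> f \<le> K powr (1 / p) * 2 powr real \<alpha> * real n powr real \<alpha>" .
    then have "d / (K powr (1 / p) * 2 powr real \<alpha> * real n powr real \<alpha>) \<le>
        cmod (weighted_integral (rho q m \<upsilon>) f - quadrature n w x f) / sobolev_norm q m \<alpha> p \<beta> f"
      using err d pos by (intro frac_le) auto
    moreover have "d / (K powr (1 / p) * 2 powr real \<alpha> * real n powr real \<alpha>) = c * real n powr (- real \<alpha>)"
      by (simp add: c_def powr_minus_divide)
    ultimately show ?thesis
      by (intro SUP_upper2[OF adm]) simp
  qed
  ultimately show ?thesis by blast
qed

end
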